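(* Let $H$ be a strictly balanced graph. Then there are $n_0, c, C, \xi > 0$ such that the following holds. For $n \ge n_0$ and $p \in [0,1]$, let $X$ be the number of copies of $H$ in the binomial random graph $G_{n,p}$ and let $\mu = \mathbb{E} X$. Then $$\mathbb{P}(X \ge \mu + t) \le C \exp\bigl(-c t^2/\operatorname{Var} X\bigr)$$ whenever $n \ge n_0$ and $0 < t \le \mu \le (\log n)^{1+\xi}$.
   Context: For a graph $J$ let $v_J$, $e_J$ be its numbers of vertices and edges, and let $d(J) = e_J/v_J$. A graph $H$ is strictly balanced if $e_H \ge 1$ and $d(H) > d(J)$ for all proper subgraphs $J \subsetneq H$ with $v_J \ge 1$. $G_{n,p}$ is the random graph on vertex set $\{1,\dots,n\}$ in which each possible edge is present independently with probability $p$. A copy of $H$ is a (not necessarily induced) subgraph isomorphic to $H$. *)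

theory Defs
  imports "HOL-Probability.Probability" "HOL-Library.Ramsey"
begin

type_synonym 'a graph = "'a set \<times> 'a set set"

abbreviation verts :: "'a graph \<Rightarrow> 'a set" where "verts \<equiv> fst"

abbreviation edges :: "'a graph \<Rightarrow> 'a set set" where "edges \<equiv> snd"

definition finite_simple_graph :: "'a graph \<Rightarrow> bool" where
  "finite_simple_graph G \<longleftrightarrow> finite (verts G) \<and> edges G \<subseteq> nsets (verts G) 2"

definition subgraph :: "'a graph \<Rightarrow> 'a graph \<Rightarrow> bool" where
  "subgraph J G \<longleftrightarrow> finite_simple_graph J \<and> verts J \<subseteq> verts G \<and> edges J \<subseteq> edges G"

definition graph_isomorphic :: "'a graph \<Rightarrow> 'b graph \<Rightarrow> bool" where
  "graph_isomorphic G H \<longleftrightarrow>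
    (\<exists>f. bij_betw f (verts G) (verts H) \<and> edges H = (\<lambda>e. f ` e) ` edges G)"

definition density :: "'a graph \<Rightarrow> real" where
  "density J = real (card (edges J)) / real (card (verts J))"

definition strictly_balanced :: "'a graph \<Rightarrow> bool" where
  "strictly_balanced H \<longleftrightarrow>
    card (edges H) \<ge> 1 \<and>
    (\<forall>J. subgraph J H \<and> J \<noteq> H \<and> card (verts J) \<ge> 1 \<longrightarrow> density H > density J)"

definition num_copies :: "'a graph \<Rightarrow> 'b graph \<Rightarrow> nat" where
  "num_copies H G = card {J. subgraph J G \<and> graph_isomorphic J H}"

text \<open>The function \<open>f\<close> below gives the independent indicators of the possible edges.
  Its default value \<open>False\<close> outside of \<open>nsets {1..n} 2\<close> is irrelevant.\<close>

definition binomial_random_graph :: "nat \<Rightarrow> real \<Rightarrow> nat graph pmf" where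
  "binomial_random_graph n p =
    map_pmf (\<lambda>f. ({1..n}, {e \<in> nsets {1..n} 2. f e}))
      (Pi_pmf (nsets {1..n} 2) False (\<lambda>_. bernoulli_pmf p))"

end

(*  Let k be the number of edges of H, and K = t^2 / mu. Split the copies of H into the isolated ones,
    sharing no edge with another copy, and the clustered ones. The isolated copies are edge-disjoint, so
    E (1 + y)^I <= exp (y mu) for their number I, which gives a Chernoff bound. If there are many
    clustered copies, then they can be explored greedily by adding to the union U of the edges seen so
    far either a copy meeting U or two overlapping copies disjoint from U. By strict balancedness each
    such step has expected number at most n^(-1/(2k)) as long as U has polylogarithmic size, so about
    K / log n steps have probability at most exp (-cK). Fewer steps yield at most (2kK / log n)^k < t/2
    clustered copies, for K <= mu <= (log n)^(1 + 1/k). Finally Var X >= mu / 2, as the indicators of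
    the copies are positively correlated.  *)

theory Submission
  imports Defs "HOL-Real_Asymp.Real_Asymp"
begin

section \<open>Families of sets of equal size in a random set\<close>

lemma binomial_le_power: "n choose r \<le> n ^ r"
  by (cases "r \<le> n") (simp_all add: binomial_le_pow binomial_eq_0)

text \<open>Copies of a graph enter this part only as sets of \<open>k\<close> edges. About the law
  of \<open>M\<close> only the inclusion probabilities and the range \<open>Pow E\<close> are
  assumed, which is enough for moments and union bounds.\<close>

locale random_family =
  fixes E :: "'e set" and p :: real and M :: "'e set pmf" and \<F> :: "'e set set" and k :: nat
  assumes finite_E: "finite E"
    and p_nonneg: "0 \<le> p" and p_le_1: "p \<le> 1"
    and set_M: "set_pmf M \<subseteq> Pow E"
    and prob_superset: "A \<subseteq> E \<Longrightarrow> measure_pmf.prob M {R. A \<subseteq> R} = p ^ card A"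
    and members: "A \<in> \<F> \<Longrightarrow> A \<subseteq> E"
    and card_members: "A \<in> \<F> \<Longrightarrow> card A = k"
    and k_pos: "k \<ge> 1"
begin

definition X :: "'e set \<Rightarrow> real" where
  "X R = real (card {A \<in> \<F>. A \<subseteq> R})"

definition \<mu> :: real where
  "\<mu> = real (card \<F>) * p ^ k"

lemma finite_F: "finite \<F>"
  using finite_subset[of \<F> "Pow E"] members finite_E by auto

lemma finite_member: "A \<in> \<F> \<Longrightarrow> finite A"
  using finite_subset members finite_E by blast

lemma integrable_M [simp]: "integrable (measure_pmf M) (f :: 'e set \<Rightarrow> real)"
  using finite_subset[OF set_M] finite_E by (intro integrable_measure_pmf_finite) auto

lemma \<mu>_nonneg: "\<mu> \<ge> 0"
  using p_nonneg by (simp add: \<mu>_def)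

lemma expectation_superset:
  "A \<subseteq> E \<Longrightarrow> measure_pmf.expectation M (\<lambda>R. of_bool (A \<subseteq> R)) = p ^ card A"
proof -
  assume "A \<subseteq> E"
  have "(\<lambda>R. of_bool (A \<subseteq> R) :: real) = indicator {R. A \<subseteq> R}"
    by (auto simp: indicator_def)
  then show ?thesis
    using prob_superset[OF \<open>A \<subseteq> E\<close>] by simp
qed

lemma X_eq_sum: "X R = (\<Sum>A\<in>\<F>. of_bool (A \<subseteq> R))"
  using finite_F by (simp add: X_def Int_def)

lemma expectation_X: "measure_pmf.expectation M X = \<mu>"
proof -
  have "measure_pmf.expectation M X = (\<Sum>A\<in>\<F>. measure_pmf.expectation M (\<lambda>R. of_bool (A \<subseteq> R)))"
    unfolding X_eq_sum[abs_def] by (rule Bochner_Integration.integral_sum) simp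
  also have "\<dots> = (\<Sum>A\<in>\<F>. p ^ k)"
    by (intro sum.cong refl) (simp add: expectation_superset members card_members)
  finally show ?thesis by (simp add: \<mu>_def)
qed

text \<open>The second moment is the sum of \<open>p ^ card (A \<union> B)\<close> over ordered
  pairs. Since the union has at most \<open>2 * k\<close> elements, no pair contributes less than in
  the independent case, and each diagonal pair contributes \<open>p ^ k - p ^ (2 * k)\<close>
  more.\<close>

lemma variance_X_ge: "measure_pmf.variance M X \<ge> \<mu> * (1 - p ^ k)"
proof -
  have sq: "(X R)\<^sup>2 = (\<Sum>(A, B)\<in>\<F> \<times> \<F>. of_bool (A \<union> B \<subseteq> R))" for R
    unfolding X_eq_sum power2_eq_square sum_product sum.cartesian_product
    by (intro sum.cong) auto
  have "measure_pmf.expectation M (\<lambda>R. (X R)\<^sup>2) =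
      (\<Sum>q\<in>\<F> \<times> \<F>. measure_pmf.expectation M (\<lambda>R. case q of (A, B) \<Rightarrow> of_bool (A \<union> B \<subseteq> R)))"
    unfolding sq by (rule Bochner_Integration.integral_sum) simp
  also have "\<dots> = (\<Sum>(A, B)\<in>\<F> \<times> \<F>. p ^ card (A \<union> B))"
  proof (intro sum.cong refl, clarify)
    fix A B assume "A \<in> \<F>" "B \<in> \<F>"
    then have "A \<union> B \<subseteq> E" using members by blast
    from expectation_superset[OF this]
    show "measure_pmf.expectation M (\<lambda>R. of_bool (A \<union> B \<subseteq> R)) = p ^ card (A \<union> B)" .
  qed
  finally have second: "measure_pmf.expectation M (\<lambda>R. (X R)\<^sup>2) =
    (\<Sum>(A, B)\<in>\<F> \<times> \<F>. p ^ card (A \<union> B))" .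
  have "(\<Sum>(A, B)\<in>\<F> \<times> \<F>. p ^ (2 * k) + of_bool (A = B) * (p ^ k - p ^ (2 * k)))
      \<le> (\<Sum>(A, B)\<in>\<F> \<times> \<F>. p ^ card (A \<union> B))"
  proof (intro sum_mono, clarify)
    fix A B assume AB: "A \<in> \<F>" "B \<in> \<F>"
    show "p ^ (2 * k) + of_bool (A = B) * (p ^ k - p ^ (2 * k)) \<le> p ^ card (A \<union> B)"
    proof (cases "A = B")
      case False
      have "card (A \<union> B) \<le> 2 * k"
        using card_Un_le[of A B] AB card_members by simp
      then show ?thesis
        using False p_nonneg p_le_1 by (simp add: power_decreasing)
    qed (simp add: AB card_members)
  qed
  also have "(\<Sum>(A, B)\<in>\<F> \<times> \<F>. p ^ (2 * k) + of_bool (A = B) * (p ^ k - p ^ (2 * k)))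
      = (\<Sum>A\<in>\<F>. \<Sum>B\<in>\<F>. p ^ (2 * k) + of_bool (A = B) * (p ^ k - p ^ (2 * k)))"
    by (simp add: sum.cartesian_product)
  also have "\<dots> = \<mu>\<^sup>2 + \<mu> * (1 - p ^ k)"
  proof -
    have "(\<Sum>B\<in>\<F>. p ^ (2 * k) + of_bool (A = B) * (p ^ k - p ^ (2 * k)))
        = card \<F> * p ^ (2 * k) + (p ^ k - p ^ (2 * k))" if "A \<in> \<F>" for A
    proof -
      have "(\<Sum>B\<in>\<F>. of_bool (A = B) * (p ^ k - p ^ (2 * k))) = (\<Sum>B\<in>{A}. p ^ k - p ^ (2 * k))"
        using finite_F that by (intro sum.mono_neutral_cong_right) auto
      then show ?thesis by (simp add: sum.distrib)
    qed
    then have diag: "(\<Sum>A\<in>\<F>. \<Sum>B\<in>\<F>. p ^ (2 * k) + of_bool (A = B) * (p ^ k - p ^ (2 * k)))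
        = (\<Sum>A\<in>\<F>. card \<F> * p ^ (2 * k) + (p ^ k - p ^ (2 * k)))"
      by (intro sum.cong refl)
    show ?thesis
      unfolding diag
      by (simp add: \<mu>_def power2_eq_square mult_2 mult_2_right power_add algebra_simps)
  qed
  finally show ?thesis
    using second by (subst measure_pmf.variance_eq) (simp_all add: expectation_X)
qed

section \<open>Chernoff bound for the isolated members\<close>

definition isolated :: "'e set \<Rightarrow> 'e set set" where
  "isolated R = {A \<in> \<F>. A \<subseteq> R \<and> (\<forall>B\<in>\<F>. B \<subseteq> R \<longrightarrow> B \<noteq> A \<longrightarrow> A \<inter> B = {})}"

definition clustered :: "'e set \<Rightarrow> 'e set set" where
  "clustered R = {A \<in> \<F>. A \<subseteq> R \<and> (\<exists>B\<in>\<F>. B \<subseteq> R \<and> B \<noteq> A \<and> A \<inter> B \<noteq> {})}"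

lemma X_split: "X R = real (card (isolated R)) + real (card (clustered R))"
proof -
  have "{A \<in> \<F>. A \<subseteq> R} = isolated R \<union> clustered R" "isolated R \<inter> clustered R = {}"
    by (auto simp: isolated_def clustered_def)
  moreover have "finite (isolated R)" "finite (clustered R)"
    using finite_F by (auto simp: isolated_def clustered_def)
  ultimately show ?thesis
    by (simp add: X_def card_Un_disjoint)
qed

text \<open>The power expands into a sum of \<open>y ^ card S\<close> over the sets \<open>S\<close>
  of isolated members. Each such \<open>S\<close> is pairwise disjoint, so \<open>R\<close> contains
  its union with probability exactly \<open>p ^ (k * card S)\<close>.\<close>

lemma expectation_isolated:
  assumes "y \<ge> 0"
  shows "measure_pmf.expectation M (\<lambda>R. (1 + y) ^ card (isolated R)) \<le> exp (y * \<mu>)"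
proof -
  define D where "D = {S \<in> Pow \<F>. pairwise disjnt S}"
  have finD: "finite D" using finite_F by (simp add: D_def)
  have binom: "(1 + z) ^ card I = (\<Sum>S\<in>Pow I. z ^ card S)" if "finite I"
    for z :: real and I :: "'e set set"
    using prod_add[OF that, of "\<lambda>_. z" "\<lambda>_. 1"] by (simp add: add.commute)
  have "(1 + y) ^ card (isolated R) \<le> (\<Sum>S\<in>D. y ^ card S * of_bool (\<Union>S \<subseteq> R))" for R
  proof -
    have "pairwise disjnt (isolated R)"
      unfolding pairwise_def disjnt_def isolated_def by blast
    then have sub: "Pow (isolated R) \<subseteq> D"
      by (auto simp: D_def isolated_def intro: pairwise_subset)
    have "(1 + y) ^ card (isolated R) = (\<Sum>S\<in>Pow (isolated R). y ^ card S)"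
      by (rule binom) (use finite_F in \<open>simp add: isolated_def\<close>)
    also have "\<dots> = (\<Sum>S\<in>Pow (isolated R). y ^ card S * of_bool (\<Union>S \<subseteq> R))"
      by (intro sum.cong refl) (auto simp: isolated_def)
    also have "\<dots> \<le> (\<Sum>S\<in>D. y ^ card S * of_bool (\<Union>S \<subseteq> R))"
      using assms by (intro sum_mono2 finD sub) auto
    finally show ?thesis .
  qed
  then have "measure_pmf.expectation M (\<lambda>R. (1 + y) ^ card (isolated R))
      \<le> measure_pmf.expectation M (\<lambda>R. \<Sum>S\<in>D. y ^ card S * of_bool (\<Union>S \<subseteq> R))"
    by (intro integral_mono) simp_all
  also have "\<dots> = (\<Sum>S\<in>D. measure_pmf.expectation M (\<lambda>R. y ^ card S * of_bool (\<Union>S \<subseteq> R)))"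
    by (rule Bochner_Integration.integral_sum) simp
  also have "\<dots> = (\<Sum>S\<in>D. (y * p ^ k) ^ card S)"
  proof (intro sum.cong refl)
    fix S assume S: "S \<in> D"
    then have "card (\<Union>S) = (\<Sum>A\<in>S. card A)"
      by (intro card_Union_disjoint) (auto simp: D_def finite_member)
    also have "\<dots> = (\<Sum>A\<in>S. k)"
      by (intro sum.cong refl) (use S in \<open>auto simp: D_def card_members\<close>)
    also have "\<dots> = k * card S" by simp
    finally have "card (\<Union>S) = k * card S" .
    moreover have "\<Union>S \<subseteq> E" using S members by (auto simp: D_def)
    ultimately show "measure_pmf.expectation M (\<lambda>R. y ^ card S * of_bool (\<Union>S \<subseteq> R)) = (y * p ^ k) ^ card S"
      by (simp add: expectation_superset power_mult_distrib power_mult)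
  qed
  \<comment> \<open>Adding the nonnegative terms of the families that are not disjoint completes the
    binomial expansion over all of \<open>\<F>\<close>, as if its members were independent.\<close>
  also have "\<dots> \<le> (\<Sum>S\<in>Pow \<F>. (y * p ^ k) ^ card S)"
    using assms p_nonneg finite_F by (intro sum_mono2) (auto simp: D_def)
  also have "\<dots> = (1 + y * p ^ k) ^ card \<F>"
    using binom[OF finite_F] by simp
  also have "\<dots> \<le> exp (y * p ^ k) ^ card \<F>"
    using assms p_nonneg by (intro power_mono exp_ge_add_one_self) simp
  also have "\<dots> = exp (y * \<mu>)"
    by (simp add: \<mu>_def mult_ac flip: exp_of_nat_mult)
  finally show ?thesis .
qed

lemma prob_isolated_ge:
  assumes "0 < s" "s \<le> \<mu>"
  shows "measure_pmf.prob M {R. real (card (isolated R)) \<ge> \<mu> + s} \<le> exp (- s\<^sup>2 / (8 * \<mu>))"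
proof -
  \<comment> \<open>This value minimises \<open>- s * y + 2 * \<mu> * y\<^sup>2\<close>, the bound
    on the exponent reached below. The minimum is \<open>- s\<^sup>2 / (8 * \<mu>)\<close>, and
    \<open>y \<le> 1\<close> holds because \<open>s \<le> \<mu>\<close>.\<close>
  define y where "y = s / (4 * \<mu>)"
  have \<mu>: "\<mu> > 0" using assms by simp
  have y: "0 < y" "y \<le> 1" using assms \<mu> by (simp_all add: y_def field_simps)
  define b where "b = (1 + y) powr (\<mu> + s)"
  have b: "b > 0" using y by (simp add: b_def)
  have "measure_pmf.prob M {R. real (card (isolated R)) \<ge> \<mu> + s}
      = measure_pmf.prob M {R \<in> space M. (1 + y) ^ card (isolated R) \<ge> b}"
    using y by (simp add: b_def flip: powr_realpow)
  also have "\<dots> \<le> measure_pmf.expectation M (\<lambda>R. (1 + y) ^ card (isolated R)) / b"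
    using y b by (intro integral_Markov_inequality_measure) auto
  also have "\<dots> \<le> exp (y * \<mu>) / b"
    using b y by (intro divide_right_mono expectation_isolated) auto
  also have "\<dots> = exp (y * \<mu> - (\<mu> + s) * ln (1 + y))"
    using y by (simp add: b_def powr_def exp_diff)
  also have "\<dots> \<le> exp (- s\<^sup>2 / (8 * \<mu>))"
  proof -
    have "(\<mu> + s) * (y - y\<^sup>2) \<le> (\<mu> + s) * ln (1 + y)"
      using assms \<mu> y by (intro mult_left_mono ln_one_plus_pos_lower_bound) auto
    moreover have "s * y\<^sup>2 \<le> \<mu> * y\<^sup>2" using assms by (intro mult_right_mono) auto
    moreover have "- s * y + 2 * \<mu> * y\<^sup>2 = - s\<^sup>2 / (8 * \<mu>)"
      using \<mu> by (simp add: y_def field_simps power2_eq_square)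
    ultimately show ?thesis by (simp add: algebra_simps)
  qed
  finally show ?thesis .
qed

section \<open>Greedy exploration of the clustered members\<close>

definition attachments :: "'e set \<Rightarrow> 'e set set" where
  "attachments U = {A \<in> \<F>. A \<inter> U \<noteq> {} \<and> \<not> A \<subseteq> U}"

text \<open>For \<open>p > 0\<close> this is the conditional expectation of the number of
  attachments contained in the random set, given that it contains \<open>U\<close>.\<close>

definition attach_weight :: "'e set \<Rightarrow> real" where
  "attach_weight U = (\<Sum>A\<in>attachments U. p ^ card (A - U))"

text \<open>These are the steps that start a new component. Disjointness from \<open>U\<close> lets
  the probability factor into that of \<open>U\<close>, that of \<open>A\<close>, and the attachment
  cost of \<open>B\<close> to \<open>A\<close>.\<close>

definition new_pairs :: "'e set \<Rightarrow> ('e set \<times> 'e set) set" where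
  "new_pairs U = {(A, B). A \<in> \<F> \<and> B \<in> attachments A \<and> (A \<union> B) \<inter> U = {}}"

text \<open>Only the union reached after exactly \<open>m\<close> steps is kept, not the order of
  exploration, so a union bound over \<open>clusters m\<close> costs at most the sum over all
  explorations.\<close>

primrec clusters :: "nat \<Rightarrow> 'e set set" where
  "clusters 0 = {{}}"
| "clusters (Suc m) =
    (\<lambda>(U, A). U \<union> A) ` Sigma (clusters m) attachments \<union>
    (\<lambda>(U, A, B). U \<union> (A \<union> B)) ` Sigma (clusters m) new_pairs"

lemma finite_attachments: "finite (attachments U)"
  using finite_F by (simp add: attachments_def)

lemma new_pairs_subset: "new_pairs U \<subseteq> Sigma \<F> attachments"
  by (auto simp: new_pairs_def)

lemma finite_new_pairs: "finite (new_pairs U)"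
  using new_pairs_subset by (rule finite_subset) (simp add: finite_F finite_attachments)

lemma finite_clusters: "finite (clusters m)"
  by (induction m) (auto simp: finite_attachments finite_new_pairs)

lemma attachments_subset: "A \<in> attachments U \<Longrightarrow> A \<subseteq> E" "A \<in> attachments U \<Longrightarrow> card A = k"
  by (auto simp: attachments_def dest: members card_members)

lemma clusters_Suc_cases:
  assumes "U \<in> clusters (Suc m)"
  obtains V A where "V \<in> clusters m" "A \<in> attachments V" "U = V \<union> A"
    | V A B where "V \<in> clusters m" "A \<in> \<F>" "B \<in> attachments A" "U = V \<union> (A \<union> B)"
  using assms by (auto simp: new_pairs_def)

lemma clusters_subset: "U \<in> clusters m \<Longrightarrow> U \<subseteq> E"
proof (induction m arbitrary: U)
  case (Suc m)
  from Suc.prems show ?case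
  proof (cases rule: clusters_Suc_cases)
    case (1 V A)
    then show ?thesis using Suc.IH[of V] attachments_subset(1)[of A V] by simp
  next
    case (2 V A B)
    then show ?thesis using Suc.IH[of V] attachments_subset(1)[of B A] members[of A] by simp
  qed
qed simp

lemma card_clusters: "U \<in> clusters m \<Longrightarrow> card U \<le> 2 * k * m"
proof (induction m arbitrary: U)
  case (Suc m)
  from Suc.prems show ?case
  proof (cases rule: clusters_Suc_cases)
    case (1 V A)
    then show ?thesis
      using Suc.IH[of V] card_Un_le[of V A] attachments_subset(2)[of A V] by simp
  next
    case (2 V A B)
    then show ?thesis
      using Suc.IH[of V] card_Un_le[of V "A \<union> B"] card_Un_le[of A B] attachments_subset(2)[of B A]
        card_members[of A] by simp
  qed
qed simp

text \<open>Attaching one member to \<open>U\<close> multiplies the weight by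
  \<open>attach_weight U\<close>, at most \<open>w\<close>. A new pair multiplies it by at most the
  sum of \<open>p ^ k * attach_weight A\<close> over all \<open>A\<close>, hence by
  \<open>\<mu> * w\<close>. The maximum in the hypothesis covers both uses: \<open>U\<close> a
  cluster, and \<open>U\<close> a single member of size \<open>k\<close>.\<close>

lemma cluster_weight_Suc:
  assumes "\<And>U. U \<subseteq> E \<Longrightarrow> card U \<le> max k (2 * k * m) \<Longrightarrow> attach_weight U \<le> w"
  shows "(\<Sum>U\<in>clusters (Suc m). p ^ card U) \<le> w * (1 + \<mu>) * (\<Sum>U\<in>clusters m. p ^ card U)"
proof -
  have fin: "finite U" if "U \<in> clusters m" for U
    using clusters_subset[OF that] finite_E finite_subset by blast
  let ?P = "Sigma (clusters m) attachments" and ?Q = "Sigma (clusters m) new_pairs"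
  have finP: "finite ?P" "finite ?Q"
    by (auto simp: finite_clusters finite_attachments finite_new_pairs)
  have "(\<Sum>U\<in>clusters (Suc m). p ^ card U) \<le>
      (\<Sum>U\<in>(\<lambda>(U, A). U \<union> A) ` ?P. p ^ card U) + (\<Sum>U\<in>(\<lambda>(U, A, B). U \<union> (A \<union> B)) ` ?Q. p ^ card U)"
    using finP p_nonneg by (simp add: sum_Un sum_nonneg)
  also have "\<dots> \<le> (\<Sum>(U, A)\<in>?P. p ^ card (U \<union> A)) + (\<Sum>(U, A, B)\<in>?Q. p ^ card (U \<union> (A \<union> B)))"
    using sum_image_le[OF finP(1), of "\<lambda>U. p ^ card U" "\<lambda>(U, A). U \<union> A"]
      sum_image_le[OF finP(2), of "\<lambda>U. p ^ card U" "\<lambda>(U, A, B). U \<union> (A \<union> B)"] p_nonneg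
    by (intro add_mono) (simp_all add: o_def case_prod_unfold)
  also have "\<dots> = (\<Sum>U\<in>clusters m. (\<Sum>A\<in>attachments U. p ^ card (U \<union> A)) +
      (\<Sum>(A, B)\<in>new_pairs U. p ^ card (U \<union> (A \<union> B))))"
    by (simp add: sum.Sigma finite_clusters finite_attachments finite_new_pairs sum.distrib)
  also have "\<dots> \<le> (\<Sum>U\<in>clusters m. w * (1 + \<mu>) * p ^ card U)"
  proof (intro sum_mono)
    fix U assume U: "U \<in> clusters m"
    have finU: "finite U" using fin U .
    have split: "p ^ card (U \<union> A) = p ^ card U * p ^ card (A - U)" if "finite A" for A
      using card_Un_disjoint[of U "A - U"] finU that
      by (simp add: power_add Diff_disjoint)
    have "(\<Sum>A\<in>attachments U. p ^ card (U \<union> A)) = p ^ card U * attach_weight U"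
      unfolding attach_weight_def sum_distrib_left
      by (intro sum.cong refl split) (simp add: attachments_def finite_member)
    also have "\<dots> \<le> p ^ card U * w"
      using card_clusters[OF U] clusters_subset[OF U] p_nonneg
      by (intro mult_left_mono assms) (auto simp: le_max_iff_disj)
    finally have 1: "(\<Sum>A\<in>attachments U. p ^ card (U \<union> A)) \<le> p ^ card U * w" .
    have "(\<Sum>(A, B)\<in>new_pairs U. p ^ card (U \<union> (A \<union> B)))
        = (\<Sum>(A, B)\<in>new_pairs U. p ^ card U * (p ^ k * p ^ card (B - A)))"
    proof (intro sum.cong refl, clarify)
      fix A B assume AB: "(A, B) \<in> new_pairs U"
      then have AB': "A \<in> \<F>" "B \<in> \<F>" "(A \<union> B) \<inter> U = {}"
        by (auto simp: new_pairs_def attachments_def)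
      then have "card (U \<union> (A \<union> B)) = card U + (card A + card (B - A))"
        using card_Un_disjoint[of U "A \<union> B"] card_Un_disjoint[of A "B - A"] finU finite_member
        by (auto simp: Int_commute)
      then show "p ^ card (U \<union> (A \<union> B)) = p ^ card U * (p ^ k * p ^ card (B - A))"
        using AB' by (simp add: power_add card_members)
    qed
    \<comment> \<open>Disjointness from \<open>U\<close> has served its purpose in the factorisation
      and is dropped.\<close>
    also have "\<dots> \<le> (\<Sum>(A, B)\<in>Sigma \<F> attachments. p ^ card U * (p ^ k * p ^ card (B - A)))"
      using p_nonneg by (intro sum_mono2 new_pairs_subset) (auto simp: finite_F finite_attachments)
    also have "\<dots> = p ^ card U * (\<Sum>A\<in>\<F>. p ^ k * attach_weight A)"
      by (simp add: sum.Sigma[symmetric] finite_F finite_attachments attach_weight_def sum_distrib_left)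
    also have "\<dots> \<le> p ^ card U * (\<Sum>A\<in>\<F>. p ^ k * w)"
      using p_nonneg members card_members by (intro mult_left_mono sum_mono assms) auto
    finally have "(\<Sum>(A, B)\<in>new_pairs U. p ^ card (U \<union> (A \<union> B))) \<le> p ^ card U * (\<mu> * w)"
      by (simp add: \<mu>_def mult_ac)
    with 1 show "(\<Sum>A\<in>attachments U. p ^ card (U \<union> A)) +
      (\<Sum>(A, B)\<in>new_pairs U. p ^ card (U \<union> (A \<union> B))) \<le> w * (1 + \<mu>) * p ^ card U"
      by (simp add: algebra_simps)
  qed
  finally show ?thesis by (simp add: sum_distrib_left)
qed

text \<open>The bound on the attachment weight is needed only up to \<open>m - 1\<close> steps,
  since the last step starts from such a union.\<close>

lemma cluster_weight:
  assumes "\<And>U. U \<subseteq> E \<Longrightarrow> card U \<le> max k (2 * k * (m - 1)) \<Longrightarrow> attach_weight U \<le> w" "w \<ge> 0"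
  shows "(\<Sum>U\<in>clusters m. p ^ card U) \<le> (w * (1 + \<mu>)) ^ m"
  using assms(1)
proof (induction m)
  case (Suc m)
  have le: "2 * k * (m - 1) \<le> 2 * k * m" by simp
  have "(\<Sum>U\<in>clusters (Suc m). p ^ card U) \<le> w * (1 + \<mu>) * (\<Sum>U\<in>clusters m. p ^ card U)"
    by (rule cluster_weight_Suc) (use Suc.prems in simp)
  also have "\<dots> \<le> w * (1 + \<mu>) * (w * (1 + \<mu>)) ^ m"
    using \<mu>_nonneg assms(2) le
    by (intro mult_left_mono Suc.IH Suc.prems) (auto simp: max_def split: if_splits intro: order_trans)
  finally show ?case by simp
qed simp

lemma prob_cluster:
  "measure_pmf.prob M {R. \<exists>U\<in>clusters m. U \<subseteq> R} \<le> (\<Sum>U\<in>clusters m. p ^ card U)"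
proof -
  have "{R. \<exists>U\<in>clusters m. U \<subseteq> R} = (\<Union>U\<in>clusters m. {R. U \<subseteq> R})" by auto
  also have "measure_pmf.prob M \<dots> \<le> (\<Sum>U\<in>clusters m. measure_pmf.prob M {R. U \<subseteq> R})"
    by (rule measure_UNION_le) (simp_all add: finite_clusters)
  also have "\<dots> = (\<Sum>U\<in>clusters m. p ^ card U)"
    by (intro sum.cong refl prob_superset clusters_subset)
  finally show ?thesis .
qed

text \<open>Let \<open>B\<close> be a partner of \<open>A\<close>. If both avoid \<open>U\<close>,
  they form a new pair. If \<open>A\<close> meets \<open>U\<close>, it is an attachment. Otherwise
  \<open>B\<close> meets \<open>U\<close>, and it is not inside \<open>U\<close> because it also
  meets \<open>A\<close>, which avoids \<open>U\<close>.\<close>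

lemma cluster_extend:
  assumes "U \<in> clusters m" "U \<subseteq> R" "A \<in> clustered R" "\<not> A \<subseteq> U"
  shows "\<exists>V\<in>clusters (Suc m). V \<subseteq> R"
proof -
  obtain B where A: "A \<in> \<F>" "A \<subseteq> R" and B: "B \<in> \<F>" "B \<subseteq> R" "B \<noteq> A" "A \<inter> B \<noteq> {}"
    using assms(3) by (auto simp: clustered_def)
  \<comment> \<open>Equal sizes turn distinctness into non-inclusion, so \<open>B\<close> is an
    attachment of \<open>A\<close>.\<close>
  have BA: "\<not> B \<subseteq> A"
    using A B card_members finite_member card_subset_eq by metis
  have step: ?thesis if "C \<in> attachments U" "C \<subseteq> R" for C
    using assms(1,2) that by (auto intro!: bexI[of _ "U \<union> C"])
  show ?thesis
  proof (cases "(A \<union> B) \<inter> U = {}")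
    case True
    with A B BA have "(A, B) \<in> new_pairs U"
      by (auto simp: new_pairs_def attachments_def)
    with A B assms(1,2) show ?thesis
      by (auto intro!: bexI[of _ "U \<union> (A \<union> B)"])
  next
    case False
    show ?thesis
    proof (cases "A \<inter> U = {}")
      case True
      with False B have "B \<in> attachments U" by (auto simp: attachments_def)
      then show ?thesis using step B by blast
    next
      case False
      then have "A \<in> attachments U" using A assms(4) by (auto simp: attachments_def)
      then show ?thesis using step A by blast
    qed
  qed
qed

text \<open>At the first number of steps that cannot be realised inside \<open>R\<close>, the
  previous union \<open>U\<close> admits no extension. By \<open>cluster_extend\<close> it then
  contains every clustered member, so these are among the \<open>k\<close>-subsets of
  \<open>U\<close>.\<close>

lemma few_clustered:
  assumes "\<not> (\<exists>U\<in>clusters m. U \<subseteq> R)"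
  shows "card (clustered R) \<le> (2 * k * (m - 1)) ^ k"
proof -
  define j where "j = (LEAST j. \<not> (\<exists>U\<in>clusters j. U \<subseteq> R))"
  have j: "\<not> (\<exists>U\<in>clusters j. U \<subseteq> R)" and jm: "j \<le> m"
    unfolding j_def using assms by (rule LeastI, rule Least_le)
  from j have "j \<noteq> 0" by (intro notI) simp
  then obtain i where i: "j = Suc i" by (cases j) auto
  then have "\<exists>U\<in>clusters i. U \<subseteq> R"
    using not_less_Least[of i "\<lambda>j. \<not> (\<exists>U\<in>clusters j. U \<subseteq> R)"] by (auto simp: j_def)
  then obtain U where U: "U \<in> clusters i" "U \<subseteq> R" by blast
  have sub: "clustered R \<subseteq> {A. A \<subseteq> U \<and> card A = k}"
    using cluster_extend[OF U] j i card_members by (auto simp: clustered_def)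
  have finU: "finite U" using clusters_subset[OF U(1)] finite_E finite_subset by blast
  have "card (clustered R) \<le> card {A. A \<subseteq> U \<and> card A = k}"
    using sub finU by (intro card_mono) auto
  also have "\<dots> = card U choose k" by (rule n_subsets[OF finU])
  also have "\<dots> \<le> card U ^ k"
    by (rule binomial_le_power)
  also have "\<dots> \<le> (2 * k * (m - 1)) ^ k"
  proof (intro power_mono)
    have "card U \<le> 2 * k * i" by (rule card_clusters[OF U(1)])
    also have "\<dots> \<le> 2 * k * (m - 1)" using jm i by (intro mult_le_mono2) linarith
    finally show "card U \<le> 2 * k * (m - 1)" .
  qed simp
  finally show ?thesis .
qed

text \<open>Half of the excess \<open>t\<close> is allotted to the isolated members. If they do not
  exceed \<open>\<mu>\<close> by \<open>t / 2\<close>, then the clustered ones number more than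
  \<open>t / 2\<close>, which forces \<open>m\<close> exploration steps inside
  \<open>R\<close>.\<close>

lemma upper_tail:
  assumes "0 < t" "t \<le> \<mu>" "w \<ge> 0"
    and "\<And>U. U \<subseteq> E \<Longrightarrow> card U \<le> max k (2 * k * (m - 1)) \<Longrightarrow> attach_weight U \<le> w"
    and "real ((2 * k * (m - 1)) ^ k) < t / 2"
  shows "measure_pmf.prob M {R. X R \<ge> \<mu> + t} \<le> exp (- t\<^sup>2 / (32 * \<mu>)) + (w * (1 + \<mu>)) ^ m"
proof -
  have "\<exists>U\<in>clusters m. U \<subseteq> R"
    if "X R \<ge> \<mu> + t" "\<not> real (card (isolated R)) \<ge> \<mu> + t / 2" for R
  proof (rule ccontr)
    assume "\<not> ?thesis"
    then have "real (card (clustered R)) \<le> real ((2 * k * (m - 1)) ^ k)"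
      using few_clustered[of m R] of_nat_le_iff by blast
    then show False using assms(5) that X_split[of R] by linarith
  qed
  then have "{R. X R \<ge> \<mu> + t} \<subseteq>
      {R. real (card (isolated R)) \<ge> \<mu> + t / 2} \<union> {R. \<exists>U\<in>clusters m. U \<subseteq> R}"
    by blast
  then have "measure_pmf.prob M {R. X R \<ge> \<mu> + t} \<le>
      measure_pmf.prob M ({R. real (card (isolated R)) \<ge> \<mu> + t / 2} \<union> {R. \<exists>U\<in>clusters m. U \<subseteq> R})"
    by (intro measure_pmf.finite_measure_mono) simp_all
  also have "\<dots> \<le> measure_pmf.prob M {R. real (card (isolated R)) \<ge> \<mu> + t / 2} +
      measure_pmf.prob M {R. \<exists>U\<in>clusters m. U \<subseteq> R}"
    by (intro measure_Un_le) simp_all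
  also have "\<dots> \<le> exp (- (t / 2)\<^sup>2 / (8 * \<mu>)) + (w * (1 + \<mu>)) ^ m"
    using assms(1,2)
    by (intro add_mono prob_isolated_ge order_trans[OF prob_cluster cluster_weight] assms) auto
  finally show ?thesis by (simp add: power_divide)
qed

end

section \<open>Copies of a strictly balanced graph\<close>

definition copies :: "'a graph \<Rightarrow> nat \<Rightarrow> nat set set set" where
  "copies H n = edges ` {J. subgraph J ({1..n}, nsets {1..n} 2) \<and> graph_isomorphic J H}"

lemma Union_nsets_2_nonempty:
  assumes "B \<subseteq> nsets S 2" "B \<noteq> {}"
  shows "\<Union>B \<noteq> {}"
proof -
  obtain e where "e \<in> B" using assms by blast
  then have "e \<noteq> {}" using assms by (auto simp: nsets_def)
  with \<open>e \<in> B\<close> show ?thesis by blast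
qed

locale strictly_balanced_graph =
  fixes H :: "'a graph"
  assumes simple: "finite_simple_graph H" and balanced: "strictly_balanced H"
begin

definition v :: nat where "v = card (verts H)"
definition k :: nat where "k = card (edges H)"

lemma finite_verts: "finite (verts H)"
  using simple by (simp add: finite_simple_graph_def)

lemma edges_subset: "edges H \<subseteq> nsets (verts H) 2"
  using simple by (simp add: finite_simple_graph_def)

lemma k_pos: "k \<ge> 1"
  using balanced by (simp add: strictly_balanced_def k_def)

lemma Union_edges_subset: "\<Union>(edges H) \<subseteq> verts H"
  using edges_subset by (auto simp: nsets_def)

lemma edges_nonempty: "edges H \<noteq> {}"
  using k_pos by (auto simp: k_def)

lemma v_pos: "v \<ge> 1"
proof -
  have "verts H \<noteq> {}"
    using Union_nsets_2_nonempty[OF edges_subset edges_nonempty] Union_edges_subset by blast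
  then show ?thesis using finite_verts by (simp add: v_def Suc_leI card_gt_0_iff)
qed

text \<open>The density inequality is cross-multiplied into natural numbers, where strictness means
  a gap of at least 1. This gap is the source of the factor \<open>n powr (- 1 / k)\<close>
  below.\<close>

lemma subgraph_sparser:
  assumes "B \<subseteq> edges H" "\<Union>B \<subseteq> W" "W \<subseteq> verts H" "(W, B) \<noteq> H" "W \<noteq> {}"
  shows "card B * v < k * card W"
proof -
  have fin: "finite W" using assms finite_verts finite_subset by blast
  have "subgraph (W, B) H"
    using assms edges_subset fin by (auto simp: subgraph_def finite_simple_graph_def nsets_def)
  moreover have W: "card W \<ge> 1" using fin assms(5) by (simp add: Suc_leI card_gt_0_iff)
  ultimately have "density (W, B) < density H"
    using balanced assms(4) by (simp add: strictly_balanced_def)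
  then have "real (card B) * real v < real k * real (card W)"
    using W v_pos by (simp add: density_def v_def k_def field_simps)
  then show ?thesis by (metis of_nat_less_iff of_nat_mult)
qed

text \<open>Deleting isolated vertices would keep all edges and strictly raise the density, against
  strict balancedness.\<close>

lemma Union_edges: "\<Union>(edges H) = verts H"
proof (rule ccontr)
  assume neq: "\<Union>(edges H) \<noteq> verts H"
  have "k * v < k * card (\<Union>(edges H))"
    using subgraph_sparser[of "edges H" "\<Union>(edges H)"] neq Union_edges_subset
      Union_nsets_2_nonempty[OF edges_subset edges_nonempty]
    by (metis fst_conv k_def order_refl)
  moreover have "card (\<Union>(edges H)) \<le> v"
    unfolding v_def by (rule card_mono[OF finite_verts Union_edges_subset])
  ultimately show False by simp
qed

lemma isomorphic_copy:
  assumes "finite_simple_graph J" "bij_betw f (verts J) (verts H)" "edges H = (\<lambda>e. f ` e) ` edges J"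
  shows "\<Union>(edges J) = verts J" "card (verts J) = v" "card (edges J) = k"
proof -
  have sub: "\<Union>(edges J) \<subseteq> verts J" using assms(1) by (auto simp: finite_simple_graph_def nsets_def)
  have inj: "inj_on f (verts J)" using assms(2) by (rule bij_betw_imp_inj_on)
  have "f ` (\<Union>(edges J)) = f ` verts J"
    using Union_edges assms(2,3) by (simp add: image_Union bij_betw_imp_surj_on)
  then show "\<Union>(edges J) = verts J"
    using inj_on_image_eq_iff[OF inj sub] by simp
  show "card (verts J) = v" unfolding v_def using assms(2) by (rule bij_betw_same_card)
  have "inj_on ((`) f) (edges J)"
    by (rule inj_on_subset[OF inj_on_image_Pow[OF inj]]) (use sub in blast)
  then show "card (edges J) = k" by (simp add: k_def assms(3) card_image)
qed

lemma verts_copy: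
  assumes "subgraph J G" "graph_isomorphic J H"
  shows "verts J = \<Union>(edges J)"
proof -
  obtain f where "bij_betw f (verts J) (verts H)" "edges H = (\<lambda>e. f ` e) ` edges J"
    using assms(2) by (auto simp: graph_isomorphic_def)
  moreover have "finite_simple_graph J"
    using assms(1) by (simp add: subgraph_def)
  ultimately show ?thesis by (simp add: isomorphic_copy(1))
qed

text \<open>Copies have no isolated vertices, so the edge set determines the vertex set. This is why
  \<open>copies\<close> may record edge sets only.\<close>

lemma inj_on_edges: "inj_on edges {J. subgraph J G \<and> graph_isomorphic J H}"
proof (rule inj_onI, clarsimp)
  fix V W :: "'b set" and B
  assume "subgraph (V, B) G" "graph_isomorphic (V, B) H" "subgraph (W, B) G" "graph_isomorphic (W, B) H"
  then show "V = W" using verts_copy[of "(V, B)" G] verts_copy[of "(W, B)" G] by simp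
qed

lemma num_copies_eq:
  assumes "R \<subseteq> nsets {1..n} 2"
  shows "num_copies H ({1..n}, R) = card {A \<in> copies H n. A \<subseteq> R}"
proof -
  have "{A \<in> copies H n. A \<subseteq> R} = edges ` {J. subgraph J ({1..n}, R) \<and> graph_isomorphic J H}"
  proof (intro set_eqI iffI)
    fix A assume "A \<in> {A \<in> copies H n. A \<subseteq> R}"
    then obtain J where J: "subgraph J ({1..n}, nsets {1..n} 2)" "graph_isomorphic J H"
      and A: "A = edges J" "A \<subseteq> R"
      by (auto simp: copies_def)
    then have "subgraph J ({1..n}, R)" by (simp add: subgraph_def)
    then show "A \<in> edges ` {J. subgraph J ({1..n}, R) \<and> graph_isomorphic J H}"
      using J(2) A(1) by blast
  next
    fix A assume "A \<in> edges ` {J. subgraph J ({1..n}, R) \<and> graph_isomorphic J H}"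
    then obtain J where J: "subgraph J ({1..n}, R)" "graph_isomorphic J H" and A: "A = edges J"
      by blast
    then have "subgraph J ({1..n}, nsets {1..n} 2)" "A \<subseteq> R"
      using assms by (auto simp: subgraph_def)
    then show "A \<in> {A \<in> copies H n. A \<subseteq> R}"
      using J(2) A unfolding copies_def by blast
  qed
  then show ?thesis
    using card_image[OF inj_on_edges[of "({1..n}, R)"]] by (simp add: num_copies_def)
qed

section \<open>Numbers of copies and of extensions of a partial copy\<close>

lemma copiesE:
  assumes "A \<in> copies H n"
  obtains f where "A \<subseteq> nsets {1..n} 2" "card A = k" "card (\<Union>A) = v" "bij_betw f (\<Union>A) (verts H)"
    "edges H = (\<lambda>e. f ` e) ` A" "\<Union>A \<subseteq> {1..n}"
proof -
  obtain J where J: "subgraph J ({1..n}, nsets {1..n} 2)" "graph_isomorphic J H" "A = edges J"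
    using assms by (auto simp: copies_def)
  then obtain f where f: "bij_betw f (verts J) (verts H)" "edges H = (\<lambda>e. f ` e) ` edges J"
    by (auto simp: graph_isomorphic_def)
  have fsg: "finite_simple_graph J" "edges J \<subseteq> nsets {1..n} 2" "verts J \<subseteq> {1..n}"
    using J(1) by (auto simp: subgraph_def)
  show thesis
    using that[of f] f isomorphic_copy[OF fsg(1) f] fsg J(3) by simp
qed

lemma copies_subset: "A \<in> copies H n \<Longrightarrow> A \<subseteq> nsets {1..n} 2"
  by (rule copiesE)

lemma card_copy: "A \<in> copies H n \<Longrightarrow> card A = k"
  by (rule copiesE)

lemma finite_copies: "finite (copies H n)"
proof (rule finite_subset)
  show "copies H n \<subseteq> Pow (nsets {1..n} 2)" using copies_subset by blast
qed (simp add: finite_imp_finite_nsets)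

text \<open>Every \<open>v\<close>-subset of the vertices carries at least one copy. The resulting
  lower bound on the mean later bounds \<open>p\<close> from above.\<close>

lemma card_copies_ge:
  assumes "n \<ge> v"
  shows "(real n / real v) ^ v \<le> real (card (copies H n))"
proof -
  have "nsets {1..n} v \<subseteq> Union ` copies H n"
  proof
    fix S assume "S \<in> nsets {1..n} v"
    then have S: "S \<subseteq> {1..n}" "finite S" "card S = v" by (auto simp: nsets_def)
    obtain g where g: "bij_betw g (verts H) S"
      using finite_same_card_bij[OF finite_verts S(2)] S(3) by (auto simp: v_def)
    define J where "J = (S, (`) g ` edges H)"
    define f where "f = inv_into (verts H) g"
    have inj: "inj_on g (verts H)" using g by (rule bij_betw_imp_inj_on)
    have gS: "g ` verts H = S" using g by (rule bij_betw_imp_surj_on)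
    have "(`) g ` edges H \<subseteq> nsets S 2"
    proof (clarify)
      fix e assume "e \<in> edges H"
      then have e: "e \<subseteq> verts H" "finite e" "card e = 2" using edges_subset by (auto simp: nsets_def)
      then show "g ` e \<in> nsets S 2"
        using gS card_image[OF inj_on_subset[OF inj e(1)]] by (auto simp: nsets_def)
    qed
    then have fsg: "finite_simple_graph J" using S by (simp add: J_def finite_simple_graph_def)
    then have sub: "subgraph J ({1..n}, nsets {1..n} 2)"
      using S nsets_mono[OF S(1), of 2] by (auto simp: subgraph_def J_def finite_simple_graph_def)
    have "f ` (g ` e) = e" if "e \<in> edges H" for e
      unfolding f_def using that edges_subset
      by (intro inv_into_image_cancel[OF inj]) (auto simp: nsets_def)
    then have "edges H = (`) f ` edges J"
      by (simp add: J_def image_image)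
    moreover have "bij_betw f (verts J) (verts H)"
      unfolding f_def J_def using bij_betw_inv_into[OF g] by simp
    ultimately have iso: "graph_isomorphic J H"
      unfolding graph_isomorphic_def by blast
    have "edges J \<in> copies H n"
      unfolding copies_def using sub iso by blast
    moreover have "S = \<Union>(edges J)"
      using verts_copy[OF sub iso] by (simp add: J_def)
    ultimately show "S \<in> Union ` copies H n" by blast
  qed
  then have "card (nsets {1..n} v) \<le> card (Union ` copies H n)"
    by (intro card_mono finite_imageI finite_copies)
  also have "\<dots> \<le> card (copies H n)"
    by (intro card_image_le finite_copies)
  finally have "card (nsets {1..n} v) \<le> card (copies H n)" .
  moreover have "card (nsets {1..n} v) = n choose v" by simp
  ultimately show ?thesis
    using binomial_ge_n_over_k_pow_k[OF assms, where 'a = real] by linarith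
qed

text \<open>The isomorphism carries \<open>B\<close> with its endpoints to a subgraph of
  \<open>H\<close> with fewer edges, hence a proper one, and \<open>subgraph_sparser\<close> applies
  there.\<close>

lemma copy_sparser:
  assumes "A \<in> copies H n" "B \<subset> A" "B \<noteq> {}"
  shows "card B * v < k * card (\<Union>B)" "card (\<Union>B) \<le> v"
proof -
  obtain f where f: "A \<subseteq> nsets {1..n} 2" "card A = k" "card (\<Union>A) = v" "bij_betw f (\<Union>A) (verts H)"
    "edges H = (\<lambda>e. f ` e) ` A" "\<Union>A \<subseteq> {1..n}"
    using assms(1) by (rule copiesE)
  have inj: "inj_on f (\<Union>A)" using f(4) by (rule bij_betw_imp_inj_on)
  have injA: "inj_on ((`) f) A"
    by (rule inj_on_subset[OF inj_on_image_Pow[OF inj]]) blast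
  have UB: "\<Union>B \<subseteq> \<Union>A" using assms by blast
  have finA: "finite A" using f(2) k_pos by (intro card_ge_0_finite) simp
  have cB: "card ((`) f ` B) = card B"
    using assms(2) by (intro card_image inj_on_subset[OF injA]) auto
  have "card B < k" using psubset_card_mono[OF finA assms(2)] f(2) by simp
  then have "(\<Union>((`) f ` B), (`) f ` B) \<noteq> H" using cB by (auto simp: k_def)
  moreover have "\<Union>((`) f ` B) \<noteq> {}"
    using Union_nsets_2_nonempty[of B "{1..n}"] assms f(1) by blast
  moreover have "(`) f ` B \<subseteq> edges H" using f(5) assms(2) by blast
  moreover have "\<Union>((`) f ` B) \<subseteq> verts H" using bij_betw_imp_surj_on[OF f(4)] UB by blast
  ultimately have "card ((`) f ` B) * v < k * card (\<Union>((`) f ` B))"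
    by (intro subgraph_sparser) simp_all
  moreover have "card (\<Union>((`) f ` B)) = card (\<Union>B)"
    using card_image[OF inj_on_subset[OF inj UB]] by (simp add: image_Union)
  ultimately show "card B * v < k * card (\<Union>B)" using cB by simp
  show "card (\<Union>B) \<le> v"
    using card_mono[OF _ UB] f(3,6) finite_subset by fastforce
qed

text \<open>A copy containing \<open>B\<close> is fixed by its further vertices and a family of
  subsets of its \<open>v\<close> vertices. The double power of two is the crude count of all such
  families.\<close>

lemma card_copies_containing:
  assumes "card (\<Union>B) \<le> v"
  shows "card {A \<in> copies H n. B \<subseteq> A} \<le> 2 ^ 2 ^ v * n ^ (v - card (\<Union>B))"
proof -
  define r where "r = v - card (\<Union>B)"
  let ?N = "nsets {1..n} r"
  have fin: "finite (\<Union>B)" if "A \<in> copies H n" "B \<subseteq> A" for A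
  proof -
    have "\<Union>B \<subseteq> {1..n}"
      using copies_subset[OF that(1)] that(2) unfolding nsets_def by blast
    then show ?thesis using finite_subset by blast
  qed
  show ?thesis
  proof (cases "finite (\<Union>B)")
    case finB: True
    have "{A \<in> copies H n. B \<subseteq> A} \<subseteq> (\<Union>T\<in>?N. Pow (Pow (\<Union>B \<union> T)))"
    proof clarify
      fix A assume A: "A \<in> copies H n" "B \<subseteq> A"
      obtain f where f: "card (\<Union>A) = v" "\<Union>A \<subseteq> {1..n}"
        using A(1) by (rule copiesE)
      have "\<Union>B \<subseteq> \<Union>A" using A(2) by blast
      then have "card (\<Union>A - \<Union>B) = r"
        using card_Diff_subset[OF finB] f by (simp add: r_def)
      then have "\<Union>A - \<Union>B \<in> ?N"
        using f finite_subset[OF f(2)] by (auto simp: nsets_def)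
      then show "A \<in> (\<Union>T\<in>?N. Pow (Pow (\<Union>B \<union> T)))"
        by (rule UN_I) blast
    qed
    then have "card {A \<in> copies H n. B \<subseteq> A} \<le> card (\<Union>T\<in>?N. Pow (Pow (\<Union>B \<union> T)))"
      by (intro card_mono finite_UN_I) (auto simp: finite_imp_finite_nsets finB nsets_def)
    also have "\<dots> \<le> (\<Sum>T\<in>?N. card (Pow (Pow (\<Union>B \<union> T))))"
      by (intro card_UN_le finite_imp_finite_nsets) simp
    also have "\<dots> \<le> (\<Sum>T\<in>?N. 2 ^ 2 ^ v)"
    proof (intro sum_mono)
      fix T assume T: "T \<in> ?N"
      then have "card (\<Union>B \<union> T) \<le> v"
        using card_Un_le[of "\<Union>B" T] assms by (simp add: r_def nsets_def)
      then show "card (Pow (Pow (\<Union>B \<union> T))) \<le> 2 ^ 2 ^ v"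
        using T finB by (simp add: card_Pow nsets_def)
    qed
    also have "\<dots> = 2 ^ 2 ^ v * (n choose r)" by simp
    also have "\<dots> \<le> 2 ^ 2 ^ v * n ^ r" by (intro mult_left_mono binomial_le_power) simp
    finally show ?thesis by (simp add: r_def)
  next
    \<comment> \<open>An infinite \<open>\<Union>B\<close> has \<open>card\<close> 0 and so
      satisfies the hypothesis, but no copy contains such a \<open>B\<close>.\<close>
    case False
    then have none: "{A \<in> copies H n. B \<subseteq> A} = {}" using fin by blast
    show ?thesis unfolding none by simp
  qed
qed

end

text \<open>To be read with \<open>x\<close> the number of vertices, \<open>q\<close> the edge
  probability, and \<open>s\<close>, \<open>c\<close> the numbers of new vertices and new edges.
  After taking \<open>k\<close>-th powers the exponent of \<open>x\<close> is at most
  \<open>k * s - v * c \<le> -1\<close>, and the \<open>k\<close>-th root leaves the saving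
  \<open>x powr (- 1 / real k)\<close>.\<close>

lemma power_weight_le:
  fixes a q x :: real
  assumes "1 \<le> a" "1 \<le> x" "0 \<le> q" "q ^ k \<le> a / x ^ v" "k \<ge> 1" "k * s + 1 \<le> v * c" "c \<le> k"
  shows "x ^ s * q ^ c \<le> a * x powr (- 1 / real k)"
proof -
  have "(x ^ s * q ^ c) ^ k = x ^ (k * s) * (q ^ k) ^ c"
    by (simp only: power_mult_distrib power_mult[symmetric] mult.commute[of k s] mult.commute[of k c])
  also have "\<dots> \<le> x ^ (k * s) * (a / x ^ v) ^ c"
    using assms by (intro mult_left_mono power_mono) auto
  also have "\<dots> = x ^ (k * s) * a ^ c / x ^ (v * c)"
    by (simp only: power_divide power_mult times_divide_eq_right)
  also have "\<dots> \<le> x ^ (k * s) * a ^ k / x ^ (k * s + 1)"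
  proof (rule frac_le)
    show "x ^ (k * s) * a ^ c \<le> x ^ (k * s) * a ^ k"
      using assms by (intro mult_left_mono power_increasing) auto
    show "x ^ (k * s + 1) \<le> x ^ (v * c)"
      using assms by (intro power_increasing) auto
  qed (use assms in auto)
  also have "\<dots> = a ^ k / x"
    using assms by simp
  also have "\<dots> = (a * x powr (- 1 / real k)) ^ k"
  proof -
    have "(x powr (- 1 / real k)) ^ k = x powr (- 1)"
      using assms by (subst powr_power) auto
    also have "\<dots> = 1 / x"
      using assms by (simp add: powr_minus_divide)
    finally have *: "(x powr (- 1 / real k)) ^ k = 1 / x" .
    show ?thesis by (simp only: power_mult_distrib *) simp
  qed
  finally have *: "(x ^ s * q ^ c) ^ k \<le> (a * x powr (- 1 / real k)) ^ k" .
  show ?thesis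
  proof (rule power_le_imp_le_base)
    show "(x ^ s * q ^ c) ^ Suc (k - 1) \<le> (a * x powr (- 1 / real k)) ^ Suc (k - 1)"
      using * assms(5) by simp
  qed (use assms in auto)
qed

section \<open>The random edge set and its inclusion probabilities\<close>

definition random_subset :: "'e set \<Rightarrow> real \<Rightarrow> 'e set pmf" where
  "random_subset E p = map_pmf (\<lambda>f. {e \<in> E. f e}) (Pi_pmf E False (\<lambda>_. bernoulli_pmf p))"

lemma prob_random_subset_superset:
  assumes "finite E" "0 \<le> p" "p \<le> 1" "A \<subseteq> E"
  shows "measure_pmf.prob (random_subset E p) {R. A \<subseteq> R} = p ^ card A"
proof -
  \<comment> \<open>Containing \<open>A\<close> is a product event: coordinates in \<open>A\<close>
    are forced, all others are free.\<close>
  define B where "B = (\<lambda>e. if e \<in> A then {True} else UNIV)"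
  have "(\<lambda>f. {e \<in> E. f e}) -` {R. A \<subseteq> R} = Pi E B"
    using assms(4) by (auto simp: B_def Pi_def split: if_splits)
  then have "measure_pmf.prob (random_subset E p) {R. A \<subseteq> R}
      = measure_pmf.prob (Pi_pmf E False (\<lambda>_. bernoulli_pmf p)) (Pi E B)"
    by (simp add: random_subset_def)
  also have "\<dots> = (\<Prod>e\<in>E. measure_pmf.prob (bernoulli_pmf p) (B e))"
    by (rule measure_Pi_pmf_Pi[OF assms(1)])
  also have "\<dots> = (\<Prod>e\<in>A. p)"
    using assms by (intro prod.mono_neutral_cong_right) (auto simp: B_def measure_pmf_single)
  finally show ?thesis by simp
qed

lemma set_random_subset: "set_pmf (random_subset E p) \<subseteq> Pow E"
  by (auto simp: random_subset_def)

lemma binomial_random_graph_eq: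
  "binomial_random_graph n p = map_pmf (Pair {1..n}) (random_subset (nsets {1..n} 2) p)"
  by (simp add: binomial_random_graph_def random_subset_def pmf.map_comp o_def)

text \<open>This counts the possible traces \<open>A \<inter> U\<close> of an attachment
  \<open>A\<close>. The summand 1 keeps the base positive, so every exponent may be raised to
  \<open>k\<close> even for empty \<open>U\<close>.\<close>

lemma card_small_subsets:
  assumes "finite U"
  shows "card {B. B \<subseteq> U \<and> card B < k} \<le> k * (card U + 1) ^ k"
proof -
  have "{B. B \<subseteq> U \<and> card B < k} = (\<Union>j<k. {B. B \<subseteq> U \<and> card B = j})" by auto
  then have "card {B. B \<subseteq> U \<and> card B < k} \<le> (\<Sum>j<k. card {B. B \<subseteq> U \<and> card B = j})"
    by (simp add: card_UN_le)
  also have "\<dots> \<le> (\<Sum>j<k. (card U + 1) ^ k)"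
  proof (intro sum_mono)
    fix j assume "j \<in> {..<k}"
    then have "(card U + 1) ^ j \<le> (card U + 1) ^ k" by (intro power_increasing) auto
    moreover have "card {B. B \<subseteq> U \<and> card B = j} \<le> (card U + 1) ^ j"
      using n_subsets[OF assms, of j] binomial_le_power[of "card U" j] power_mono[of "card U" "card U + 1" j]
      by simp
    ultimately show "card {B. B \<subseteq> U \<and> card B = j} \<le> (card U + 1) ^ k" by linarith
  qed
  finally show ?thesis by simp
qed

context strictly_balanced_graph
begin

lemma copies_random_family:
  assumes "0 \<le> p" "p \<le> 1"
  shows "random_family (nsets {1..n} 2) p (random_subset (nsets {1..n} 2) p) (copies H n) k"
proof
  show "finite (nsets {1..n} 2)" by (simp add: finite_imp_finite_nsets)
  show "set_pmf (random_subset (nsets {1..n} 2) p) \<subseteq> Pow (nsets {1..n} 2)"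
    by (rule set_random_subset)
  show "measure_pmf.prob (random_subset (nsets {1..n} 2) p) {R. A \<subseteq> R} = p ^ card A"
    if "A \<subseteq> nsets {1..n} 2" for A
    using that assms by (intro prob_random_subset_superset) (auto simp: finite_imp_finite_nsets)
qed (fact assms copies_subset card_copy k_pos)+

end

section \<open>Attachment weights for copies in the random graph\<close>

locale random_copies = strictly_balanced_graph H for H :: "'a graph" +
  fixes n :: nat and p :: real
  assumes p: "0 \<le> p" "p \<le> 1" and n_ge: "n \<ge> v"
begin

sublocale random_family "nsets {1..n} 2" p "random_subset (nsets {1..n} 2) p" "copies H n" k
  using p by (rule copies_random_family)

lemma n_pos: "n > 0"
  using n_ge v_pos by simp

lemma p_power_le: "p ^ k \<le> \<mu> * real v ^ v / real n ^ v"
proof -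
  have "p ^ k * (real n / real v) ^ v \<le> p ^ k * real (card (copies H n))"
    using p by (intro mult_left_mono card_copies_ge n_ge) auto
  then show ?thesis
    using n_pos v_pos by (simp add: \<mu>_def field_simps power_divide)
qed

text \<open>Up to a constant this bounds the expected number of completions of a fixed partial copy
  \<open>B\<close>. By \<open>copy_sparser\<close> a completion needs so many edges per new vertex
  that \<open>power_weight_le\<close> applies.\<close>

lemma extension_weight:
  assumes "A \<in> copies H n" "B \<subset> A" "B \<noteq> {}"
  shows "real n ^ (v - card (\<Union>B)) * p ^ (k - card B) \<le> (1 + \<mu>) * real v ^ v * real n powr (- 1 / k)"
proof -
  define r b where "r = card (\<Union>B)" and "b = card B"
  \<comment> \<open>The factor \<open>1 + \<mu>\<close> instead of \<open>\<mu>\<close> ensures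
    \<open>a \<ge> 1\<close>, as \<open>power_weight_le\<close> demands.\<close>
  define a where "a = (1 + \<mu>) * real v ^ v"
  have r: "r \<le> v" "b * v + 1 \<le> k * r"
    using copy_sparser[OF assms] unfolding r_def b_def by simp_all
  have a1: "1 \<le> a"
    unfolding a_def using \<mu>_nonneg v_pos one_le_power[of "real v" v] mult_mono[of 1 "1 + \<mu>" 1 "real v ^ v"]
    by simp
  have pk: "p ^ k \<le> a / real n ^ v"
    using p_power_le n_pos \<mu>_nonneg
    by (elim order_trans) (simp add: a_def divide_right_mono mult_right_mono)
  have expo: "k * (v - r) + 1 \<le> v * (k - b)"
  proof -
    have "k * (v - r) = k * v - k * r" "v * (k - b) = k * v - b * v"
      by (simp_all add: diff_mult_distrib2 mult.commute)
    moreover have "k * r \<le> k * v" using r by simp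
    ultimately show ?thesis using r by linarith
  qed
  have "real n ^ (v - r) * p ^ (k - b) \<le> a * real n powr (- 1 / k)"
    using a1 n_pos p pk k_pos expo by (intro power_weight_le) simp_all
  then show ?thesis unfolding a_def r_def b_def .
qed

text \<open>Attachments are grouped by their trace \<open>B\<close> on \<open>U\<close>. There are
  polynomially many traces in \<open>card U\<close>, and each occurring one is a nonempty proper
  subset of a copy, so \<open>extension_weight\<close> bounds its group.\<close>

lemma attach_weight_le:
  assumes "U \<subseteq> nsets {1..n} 2"
  shows "attach_weight U \<le>
    real (k * (card U + 1) ^ k) * (2 ^ 2 ^ v * ((1 + \<mu>) * real v ^ v * real n powr (- 1 / k)))"
proof -
  define D where "D = (2 ^ 2 ^ v * ((1 + \<mu>) * real v ^ v * real n powr (- 1 / k)))"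
  define T where "T = {B. B \<subseteq> U \<and> card B < k}"
  have finU: "finite U" using assms finite_E finite_subset by blast
  have finT: "finite T" using finU by (simp add: T_def)
  have sub: "(\<lambda>A. A \<inter> U) ` attachments U \<subseteq> T"
  proof (clarsimp simp: T_def)
    fix A assume A: "A \<in> attachments U"
    then have "A \<inter> U \<subset> A" "A \<in> copies H n" by (auto simp: attachments_def)
    then show "card (A \<inter> U) < k"
      using psubset_card_mono finite_member card_copy by metis
  qed
  have D: "D \<ge> 0" using \<mu>_nonneg by (simp add: D_def)
  have "attach_weight U = (\<Sum>B\<in>T. \<Sum>A\<in>{A \<in> attachments U. A \<inter> U = B}. p ^ card (A - U))"
    unfolding attach_weight_def by (rule sum.group[symmetric, OF finite_attachments finT sub])
  also have "\<dots> \<le> (\<Sum>B\<in>T. D)"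
  proof (intro sum_mono)
    fix B
    let ?S = "{A \<in> attachments U. A \<inter> U = B}"
    show "(\<Sum>A\<in>?S. p ^ card (A - U)) \<le> D"
    proof (cases "?S = {}")
      case True
      show ?thesis unfolding True using D by simp
    next
      case False
      then obtain A where A: "A \<in> copies H n" "B \<subset> A" "B \<noteq> {}"
        by (auto simp: attachments_def)
      have "p ^ card (A - U) = p ^ (k - card B)" if "A \<in> ?S" for A
      proof -
        have "A \<in> copies H n" "A \<inter> U = B" using that by (auto simp: attachments_def)
        then show ?thesis
          using card_Diff_subset_Int[of A U] finU card_copy by auto
      qed
      then have "(\<Sum>A\<in>?S. p ^ card (A - U)) = real (card ?S) * p ^ (k - card B)"
        by simp
      also have "\<dots> \<le> real (2 ^ 2 ^ v * n ^ (v - card (\<Union>B))) * p ^ (k - card B)"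
      proof -
        have "card ?S \<le> card {A \<in> copies H n. B \<subseteq> A}"
          by (intro card_mono) (auto simp: finite_copies attachments_def)
        also have "\<dots> \<le> 2 ^ 2 ^ v * n ^ (v - card (\<Union>B))"
          using copy_sparser(2)[OF A] by (rule card_copies_containing)
        finally show ?thesis using p by (intro mult_right_mono of_nat_mono) auto
      qed
      also have "\<dots> = 2 ^ 2 ^ v * (real n ^ (v - card (\<Union>B)) * p ^ (k - card B))"
        by simp
      also have "\<dots> \<le> D"
        unfolding D_def by (intro mult_left_mono extension_weight[OF A]) simp
      finally show ?thesis .
    qed
  qed
  also have "\<dots> = real (card T) * D" by simp
  also have "\<dots> \<le> real (k * (card U + 1) ^ k) * D"
    using card_small_subsets[OF finU, of k] D
    by (intro mult_right_mono of_nat_mono) (simp_all add: T_def)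
  finally show ?thesis by (simp add: D_def)
qed

end

section \<open>The upper tail\<close>

text \<open>To be used with \<open>L = ln n\<close>. The bound on \<open>B\<close> keeps the
  clustered copies below \<open>t / 2\<close>, the next one serves the variance, and the last
  absorbs all polylogarithmic factors into half of the saving
  \<open>n powr (- 1 / k)\<close>.\<close>

lemma eventually_growth:
  fixes k :: nat and A B :: real
  assumes "k \<ge> 1"
  shows "eventually (\<lambda>L. 1 \<le> L \<and> B < L powr (1 / real k) \<and> A * (1 + L\<^sup>2) \<le> exp L \<and>
    real k * (2 * real k * L + 1) ^ k * (A * (1 + L\<^sup>2)\<^sup>2) \<le> exp (L / (2 * real k))) at_top"
proof -
  define r where "r = real k"
  have r: "r > 0" using assms by (simp add: r_def)
  then have "eventually (\<lambda>L. r * (2 * r * L + 1) powr r * (A * (1 + L\<^sup>2)\<^sup>2) \<le> exp (L / (2 * r))) at_top"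
    by real_asymp
  moreover have "eventually (\<lambda>L. B < L powr (1 / r)) at_top"
    using r by real_asymp
  moreover have "eventually (\<lambda>L. A * (1 + L\<^sup>2) \<le> exp L) at_top"
    by real_asymp
  ultimately show ?thesis
    using eventually_ge_at_top[of 1]
  proof eventually_elim
    case (elim L)
    have "(2 * r * L + 1) powr r = (2 * r * L + 1) ^ k"
      unfolding r_def using elim(4) by (intro powr_realpow) (simp add: add_nonneg_pos)
    with elim show ?case by (simp add: r_def)
  qed
qed

section \<open>Transfer to the random graph, and the tail bound for polylogarithmic mean\<close>

context random_copies
begin

lemma num_copies_eq_X: "R \<subseteq> nsets {1..n} 2 \<Longrightarrow> real (num_copies H ({1..n}, R)) = X R"
  unfolding X_def by (simp only: num_copies_eq)

lemma AE_num_copies_eq_X: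
  "AE R in random_subset (nsets {1..n} 2) p. real (num_copies H ({1..n}, R)) = X R"
  using set_M unfolding AE_measure_pmf_iff by (blast intro: num_copies_eq_X)

lemma expectation_num_copies:
  fixes h :: "real \<Rightarrow> real"
  shows "measure_pmf.expectation (binomial_random_graph n p) (\<lambda>G. h (real (num_copies H G))) =
    measure_pmf.expectation (random_subset (nsets {1..n} 2) p) (\<lambda>R. h (X R))"
  unfolding binomial_random_graph_eq integral_map_pmf
  by (rule integral_cong_AE) (use AE_num_copies_eq_X in \<open>auto elim: eventually_mono\<close>)

lemma prob_num_copies:
  "measure_pmf.prob (binomial_random_graph n p) {G. real (num_copies H G) \<ge> x} =
    measure_pmf.prob (random_subset (nsets {1..n} 2) p) {R. X R \<ge> x}"
  unfolding binomial_random_graph_eq measure_map_pmf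
  by (rule measure_pmf.finite_measure_eq_AE) (use AE_num_copies_eq_X in \<open>auto elim: eventually_mono\<close>)

text \<open>The hypothesis and \<open>p_power_le\<close> give \<open>p ^ k \<le> 1 / 2\<close>, so
  the factor \<open>1 - p ^ k\<close> in \<open>variance_X_ge\<close> is at least one half.\<close>

lemma variance_ge:
  assumes "\<mu> * real v ^ v \<le> real n / 2"
  shows "measure_pmf.variance (random_subset (nsets {1..n} 2) p) X \<ge> \<mu> / 2"
proof -
  have "p ^ k \<le> (\<mu> * real v ^ v) / real n ^ v" by (rule p_power_le)
  also have "\<dots> \<le> (real n / 2) / real n"
    using assms n_pos v_pos \<mu>_nonneg power_increasing[of 1 v "real n"] by (intro frac_le) auto
  also have "\<dots> = 1 / 2" using n_pos by simp
  finally have "\<mu> * (1 / 2) \<le> \<mu> * (1 - p ^ k)" using \<mu>_nonneg by (intro mult_left_mono) auto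
  then show ?thesis using variance_X_ge by simp
qed

lemma upper_tail_copies:
  defines "L \<equiv> ln (real n)"
  assumes t: "0 < t" "t \<le> \<mu>" and \<mu>_le: "\<mu> \<le> L powr (1 + 1 / real k)"
    and L1: "1 \<le> L" and Lk: "2 * (2 * real k) ^ k < L powr (1 / real k)"
    and growth: "real k * (2 * real k * L + 1) ^ k * (2 ^ 2 ^ v * real v ^ v * (1 + L\<^sup>2)\<^sup>2)
      \<le> exp (L / (2 * real k))"
  shows "measure_pmf.prob (random_subset (nsets {1..n} 2) p) {R. X R \<ge> \<mu> + t}
    \<le> 2 * exp (- (t\<^sup>2 / \<mu>) / (32 * real k))"
proof -
  define K where "K = t\<^sup>2 / \<mu>"
  \<comment> \<open>The assumed bound on \<open>\<mu>\<close> says exactly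
    \<open>\<mu> \<le> L * q\<close>, whence \<open>K / L \<le> q\<close>; this determines the
    exponent \<open>1 + 1 / real k\<close>.\<close>
  define q where "q = L powr (1 / real k)"
  \<comment> \<open>Large enough that \<open>real m * L \<ge> K\<close>, so \<open>m\<close> steps
    cost \<open>exp (- K / (2 * real k))\<close>; small enough that \<open>m - 1\<close> steps reach
    fewer than \<open>t / 2\<close> copies.\<close>
  define m where "m = nat \<lfloor>K / L\<rfloor> + 1"
  define D where "D = 2 ^ 2 ^ v * real v ^ v"
  define w where "w = real k * (2 * real k * L + 1) ^ k * (D * (1 + L\<^sup>2)) * real n powr (- 1 / real k)"
  have k1: "real k \<ge> 1" using k_pos by simp
  have \<mu>: "\<mu> > 0" using t by simp
  have K: "K > 0" "K \<le> t"
    using t \<mu> by (auto simp: K_def field_simps power2_eq_square)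
  have q: "q > 0" "q ^ k = L"
    using L1 k_pos by (simp_all add: q_def powr_power)
  have qL: "q \<le> L"
    unfolding q_def using powr_mono[of "1 / real k" 1 L] L1 k1 by simp
  have \<mu>q: "\<mu> \<le> L * q"
    using \<mu>_le L1 by (simp add: powr_add q_def)
  then have KLq: "K / L \<le> q"
    using K t L1 by (simp add: field_simps)
  have "L * q \<le> L * L" using qL L1 by (intro mult_left_mono) auto
  with \<mu>q have \<mu>L: "\<mu> \<le> L\<^sup>2" unfolding power2_eq_square by linarith
  have m: "real (m - 1) \<le> K / L" "K / L \<le> real m"
    using K L1 real_of_int_floor_add_one_ge[of "K / L"] by (simp_all add: m_def add.commute)
  have few: "real ((2 * k * (m - 1)) ^ k) < t / 2"
  proof -
    have "real ((2 * k * (m - 1)) ^ k) = (2 * real k) ^ k * real (m - 1) ^ k"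
      by (simp add: power_mult_distrib)
    also have "\<dots> \<le> (2 * real k) ^ k * (K / L) ^ k"
      using m by (intro mult_left_mono power_mono) auto
    \<comment> \<open>One factor \<open>K / L\<close> is kept and the others are bounded by
      \<open>q\<close>. As \<open>q ^ k = L\<close>, this gives \<open>K / q\<close>, linear in
      \<open>K\<close>, and \<open>Lk\<close> makes \<open>q\<close> beat the constant.\<close>
    also have "(K / L) ^ k = K / L * (K / L) ^ (k - 1)"
      using k_pos by (cases k) auto
    also have "\<dots> \<le> K / L * q ^ (k - 1)"
      using KLq K L1 by (intro mult_left_mono power_mono) auto
    also have "\<dots> = K / q"
    proof -
      have "L = q * q ^ (k - 1)"
        using q(2) k_pos by (cases k) auto
      then show ?thesis using q(1) by simp
    qed
    finally have "real ((2 * k * (m - 1)) ^ k) \<le> (2 * real k) ^ k * (K / q)"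
      by (simp add: mult_left_mono)
    also have "\<dots> < K / 2"
      using Lk K q(1) by (simp add: q_def[symmetric] field_simps)
    finally show ?thesis using K by simp
  qed
  have weight: "attach_weight U \<le> w"
    if U: "U \<subseteq> nsets {1..n} 2" "card U \<le> max k (2 * k * (m - 1))" for U
  proof -
    have "2 * real k * real (m - 1) \<le> 2 * real k * L"
      using m(1) KLq qL by (intro mult_left_mono) auto
    then have "real (2 * k * (m - 1)) \<le> 2 * real k * L" by simp
    moreover have "1 * real k \<le> (2 * L) * real k"
      using L1 by (intro mult_right_mono) auto
    then have "real k \<le> 2 * real k * L" by (simp only: mult_1 mult_ac)
    ultimately have "real (max k (2 * k * (m - 1))) \<le> 2 * real k * L"
      by (simp only: max_def simp_thms split: if_split)
    then have cU: "real (card U) \<le> 2 * real k * L"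
      using of_nat_mono[OF U(2), where 'a = real] by linarith
    have "attach_weight U \<le> real k * (real (card U) + 1) ^ k *
        (2 ^ 2 ^ v * ((1 + \<mu>) * real v ^ v * real n powr (- 1 / k)))"
      using attach_weight_le[OF U(1)] by (simp add: add.commute)
    also have "\<dots> \<le> real k * (2 * real k * L + 1) ^ k *
        (2 ^ 2 ^ v * ((1 + L\<^sup>2) * real v ^ v * real n powr (- 1 / k)))"
      using cU \<mu>L \<mu> by (intro mult_mono power_mono mult_left_mono mult_right_mono) auto
    finally show ?thesis by (simp add: w_def D_def mult_ac)
  qed
  have w0: "w \<ge> 0" using L1 by (simp add: w_def D_def)
  have "w * (1 + \<mu>) \<le> w * (1 + L\<^sup>2)"
    using w0 \<mu>L by (intro mult_left_mono) auto
  \<comment> \<open>Here \<open>n powr (- 1 / k)\<close> becomes \<open>exp (- L / k)\<close>; by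
    \<open>growth\<close> the other factors use up only half of this exponent.\<close>
  also have "\<dots> = real k * (2 * real k * L + 1) ^ k * (D * (1 + L\<^sup>2)\<^sup>2) * exp (- L / real k)"
    using n_pos by (simp add: w_def power2_eq_square powr_def L_def mult_ac)
  also have "\<dots> \<le> exp (L / (2 * real k)) * exp (- L / real k)"
    using growth by (intro mult_right_mono) (simp_all add: D_def)
  also have "\<dots> = exp (- L / (2 * real k))"
    using k1 by (simp add: field_simps flip: exp_add)
  finally have "(w * (1 + \<mu>)) ^ m \<le> exp (- L / (2 * real k)) ^ m"
    using w0 \<mu> by (intro power_mono) auto
  also have "\<dots> = exp (- (real m * L) / (2 * real k))"
    by (simp flip: exp_of_nat_mult)
  also have "\<dots> \<le> exp (- K / (32 * real k))"
  proof -
    have "K \<le> real m * L" using m(2) L1 by (simp add: field_simps)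
    then have "K / (32 * real k) \<le> real m * L / (2 * real k)"
      using k1 K by (intro frac_le) auto
    then show ?thesis by simp
  qed
  finally have clustered: "(w * (1 + \<mu>)) ^ m \<le> exp (- K / (32 * real k))" .
  \<comment> \<open>The rate \<open>1 / (32 * real k)\<close> is a common lower bound for 1/32 from
    the isolated copies and \<open>1 / (2 * real k)\<close> from the clustered ones.\<close>
  have "K / (32 * real k) \<le> K / 32"
    using k1 K by (intro divide_left_mono) auto
  then have isolated: "exp (- t\<^sup>2 / (32 * \<mu>)) \<le> exp (- K / (32 * real k))"
    by (simp add: K_def mult.commute)
  have "measure_pmf.prob (random_subset (nsets {1..n} 2) p) {R. X R \<ge> \<mu> + t}
      \<le> exp (- t\<^sup>2 / (32 * \<mu>)) + (w * (1 + \<mu>)) ^ m"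
    by (rule upper_tail[OF t w0 weight few])
  with clustered isolated
  have "measure_pmf.prob (random_subset (nsets {1..n} 2) p) {R. X R \<ge> \<mu> + t} \<le> 2 * exp (- K / (32 * real k))"
    by linarith
  then show ?thesis unfolding K_def .
qed

end

section \<open>Choice of constants and conclusion\<close>

theorem theorem6:
  fixes H :: "'a graph"
  assumes "finite_simple_graph H"
    and "strictly_balanced H"
  shows "\<exists>(n0::nat) (c::real) (C::real) (\<xi>::real). n0 > 0 \<and> c > 0 \<and> C > 0 \<and> \<xi> > 0 \<and>
    (\<forall>(n::nat) (p::real) (t::real). n \<ge> n0 \<longrightarrow> 0 \<le> p \<longrightarrow> p \<le> 1 \<longrightarrow>
      (let M = measure_pmf (binomial_random_graph n p);
           X = (\<lambda>G. real (num_copies H G));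
           \<mu> = prob_space.expectation M X
       in 0 < t \<longrightarrow> t \<le> \<mu> \<longrightarrow> \<mu> \<le> (ln (real n)) powr (1 + \<xi>) \<longrightarrow>
          measure M {G. X G \<ge> \<mu> + t} \<le> C * exp (- c * t\<^sup>2 / prob_space.variance M X)))"
proof -
  interpret strictly_balanced_graph H using assms by unfold_locales
  define A where "A = 2 ^ 2 ^ v * real v ^ v"
  let ?P = "\<lambda>L. 1 \<le> L \<and> 2 * (2 * real k) ^ k < L powr (1 / real k) \<and> A * (1 + L\<^sup>2) \<le> exp L \<and>
    real k * (2 * real k * L + 1) ^ k * (A * (1 + L\<^sup>2)\<^sup>2) \<le> exp (L / (2 * real k))"
  have "filterlim (\<lambda>n. ln (real n)) at_top sequentially"
    by real_asymp
  then have "eventually (\<lambda>n. ?P (ln (real n))) sequentially"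
    by (rule eventually_compose_filterlim[OF eventually_growth[OF k_pos]])
  then obtain n1 where n1: "\<And>n. n \<ge> n1 \<Longrightarrow> ?P (ln (real n))"
    by (auto simp: eventually_sequentially)
  \<comment> \<open>Half of the rate in \<open>upper_tail_copies\<close>; the factor 2 pays for
    replacing \<open>\<mu>\<close> by the variance, which is at least
    \<open>\<mu> / 2\<close>.\<close>
  define c where "c = 1 / (64 * real k)"
  have main: "measure_pmf.prob (binomial_random_graph n p) {G. real (num_copies H G) \<ge> \<mu> + t}
      \<le> 2 * exp (- c * t\<^sup>2 / measure_pmf.variance (binomial_random_graph n p) (\<lambda>G. real (num_copies H G)))"
    if n: "n \<ge> max n1 v" and p: "0 \<le> p" "p \<le> 1"
      and \<mu>_def: "\<mu> = measure_pmf.expectation (binomial_random_graph n p) (\<lambda>G. real (num_copies H G))"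
      and t: "0 < t" "t \<le> \<mu>" and \<mu>_le: "\<mu> \<le> ln (real n) powr (1 + 1 / real k)"
    for n p t \<mu>
  proof -
    interpret C: random_copies H n p using n p by unfold_locales auto
    let ?V = "measure_pmf.variance (binomial_random_graph n p) (\<lambda>G. real (num_copies H G))"
    define L where "L = ln (real n)"
    have L: "?P L" using n1[of n] n by (simp add: L_def)
    have \<mu>_eq: "\<mu> = C.\<mu>"
      using C.expectation_num_copies[of "\<lambda>x. x"] C.expectation_X by (simp add: \<mu>_def)
    have V_eq: "?V = measure_pmf.variance (random_subset (nsets {1..n} 2) p) C.X"
      using C.expectation_num_copies[of "\<lambda>x. (x - \<mu>)\<^sup>2"] C.expectation_X
      by (simp add: \<mu>_eq flip: \<mu>_def)
    have "\<mu> \<le> L powr 2"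
      using \<mu>_le L powr_mono[of "1 + 1 / real k" 2 L] k_pos by (simp add: L_def)
    then have "\<mu> \<le> L\<^sup>2" using L by simp
    \<comment> \<open>The aim is \<open>2 * \<mu> * v ^ v \<le> n\<close>, the hypothesis of
      \<open>variance_ge\<close>, via the third growth condition.\<close>
    then have "2 * (\<mu> * real v ^ v) \<le> 2 * (L\<^sup>2 * real v ^ v)"
      by (intro mult_left_mono mult_right_mono) auto
    also have "\<dots> \<le> A * (1 + L\<^sup>2)"
    proof -
      have "(2::real) \<le> 2 ^ 2 ^ v" using power_increasing[of 1 "2 ^ v" "2::real"] by simp
      then have "2 * (L\<^sup>2 * real v ^ v) \<le> 2 ^ 2 ^ v * ((1 + L\<^sup>2) * real v ^ v)"
        by (intro mult_mono) auto
      then show ?thesis by (simp add: A_def mult_ac)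
    qed
    also have "\<dots> \<le> exp L" using L by blast
    also have "exp L = real n" using C.n_pos by (simp add: L_def)
    finally have V: "\<mu> / 2 \<le> ?V"
      unfolding V_eq \<mu>_eq by (intro C.variance_ge) simp
    have "measure_pmf.prob (binomial_random_graph n p) {G. real (num_copies H G) \<ge> \<mu> + t}
        \<le> 2 * exp (- (t\<^sup>2 / \<mu>) / (32 * real k))"
      unfolding C.prob_num_copies \<mu>_eq
      using t \<mu>_le L by (intro C.upper_tail_copies) (simp_all add: \<mu>_eq L_def A_def)
    also have "\<dots> \<le> 2 * exp (- c * t\<^sup>2 / ?V)"
    proof -
      have "t\<^sup>2 / ?V \<le> t\<^sup>2 / (\<mu> / 2)"
        using V t by (intro divide_left_mono) auto
      then have "c * (t\<^sup>2 / ?V) \<le> c * (t\<^sup>2 / (\<mu> / 2))"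
        by (intro mult_left_mono) (auto simp: c_def)
      also have "\<dots> = (t\<^sup>2 / \<mu>) / (32 * real k)"
        by (simp add: c_def)
      finally show ?thesis by simp
    qed
    finally show ?thesis .
  qed
  show ?thesis
  proof (intro exI conjI allI impI)
    \<comment> \<open>Besides the growth threshold \<open>n1\<close>, the lower bound on the number
      of copies requires \<open>n \<ge> v\<close>.\<close>
    show "max n1 v > 0" using v_pos by simp
    show "c > 0" using k_pos by (simp add: c_def)
    show "(2::real) > 0" by simp
    show "1 / real k > 0" using k_pos by simp
    fix n :: nat and p t :: real
    assume "n \<ge> max n1 v" "0 \<le> p" "p \<le> 1"
    then show "let M = measure_pmf (binomial_random_graph n p);
           X = (\<lambda>G. real (num_copies H G));
           \<mu> = prob_space.expectation M X
       in 0 < t \<longrightarrow> t \<le> \<mu> \<longrightarrow> \<mu> \<le> (ln (real n)) powr (1 + 1 / real k) \<longrightarrow>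
          measure M {G. X G \<ge> \<mu> + t} \<le> 2 * exp (- c * t\<^sup>2 / prob_space.variance M X)"
      unfolding Let_def by (intro impI main) auto
  qed
qed

end
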